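(* Let $\rho_{AB}$ be a bipartite quantum state. The following are equivalent: (i) $\rho_{AB}$ can be used to certify steering-based randomness, i.e. there exist integers $m,d\ge1$, POVMs $\{M_{a|x}\}_{a\in[d]}$ on $A$ for $x\in\{1,\dots,m\}$, and $x^*\in\{1,\dots,m\}$ such that the assemblage $\sigma^{\rm obs}_{a|x}=\mathrm{Tr}_A[(M_{a|x}\otimes\mathbb{I}^B)\rho_{AB}]$ satisfies $P^{\rm S}_{\rm guess}(x^* )<1$; (ii) $\rho_{AB}$ can exhibit steerability (from Alice to Bob) with two measurement settings, i.e. there exist two POVMs $\{M_{a|1}\}_{a\in[d]}$, $\{M_{a|2}\}_{a\in[d]}$ on $A$ (for some $d$) such that the assemblage $\{\mathrm{Tr}_A[(M_{a|x}\otimes\mathbb{I}^B)\rho_{AB}]\}_{a\in[d],\,x\in\{1,2\}}$ does not admit a local-hidden-state model.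
   Context: All Hilbert spaces are finite-dimensional; $[d]=\{0,\dots,d-1\}$. An assemblage $\{\sigma_{a|x}\}$ admits a local-hidden-state (LHS) model if $\sigma_{a|x}=\sum_\lambda p_A(a|x,\lambda)\sigma_\lambda$ for all $a,x$, with conditional probability distributions $p_A(a|x,\lambda)$ and operators $\sigma_\lambda\succeq0$ satisfying $\sum_\lambda\mathrm{Tr}(\sigma_\lambda)=1$; otherwise it is steerable. Guessing probability for $\{\sigma^{\rm obs}_{a|x}\}_{a\in[d],x\in\{1,\dots,m\}}$: $P^{\rm S}_{\rm guess}(x^* )=\max\sum_{e\in[d]}\mathrm{Tr}(\sigma^e_{a=e|x^*})$ over families $\{\sigma^e_{a|x}\}$ of positive semidefinite operators on $B$ ($e,a\in[d]$) with $\sum_e\sigma^e_{a|x}=\sigma^{\rm obs}_{a|x}$ for all $a,x$ and $\sum_a\sigma^e_{a|x}=\sum_a\sigma^e_{a|x'}$ for all $e,x,x'$. *)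

theory Defs
  imports "HOL-Analysis.Analysis"
begin

text \<open>
  Operators on the Hilbert space with orthonormal basis indexed by a finite type \<open>'n\<close> are
  represented as matrices of type \<open>complex ^ 'n ^ 'n\<close>, with \<open>M $ i $ j\<close> the entry in row \<open>i\<close>
  and column \<open>j\<close>; the composite space of \<open>A\<close> and \<open>B\<close> has basis \<open>'a \<times> 'b\<close>.
\<close>

definition hermitian :: "complex ^ 'n ^ 'n \<Rightarrow> bool" where
  "hermitian M \<longleftrightarrow> (\<forall>i j. M $ i $ j = cnj (M $ j $ i))"

definition psd :: "complex ^ 'n::finite ^ 'n \<Rightarrow> bool" where
  "psd M \<longleftrightarrow> hermitian M \<and>
     (\<forall>v :: complex ^ 'n. 0 \<le> Re (\<Sum>i\<in>UNIV. cnj (v $ i) * (M *v v) $ i))"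

definition quantum_state :: "complex ^ 'n::finite ^ 'n \<Rightarrow> bool" where
  "quantum_state \<rho> \<longleftrightarrow> psd \<rho> \<and> trace \<rho> = 1"

definition tensor_op ::
  "complex ^ 'a ^ 'a \<Rightarrow> complex ^ 'b ^ 'b \<Rightarrow> complex ^ ('a \<times> 'b) ^ ('a \<times> 'b)" where
  "tensor_op S T = (\<chi> p q. S $ fst p $ fst q * T $ snd p $ snd q)"

definition partial_trace_A ::
  "complex ^ ('a::finite \<times> 'b::finite) ^ ('a \<times> 'b) \<Rightarrow> complex ^ 'b ^ 'b" where
  "partial_trace_A R = (\<chi> k l. \<Sum>i\<in>UNIV. R $ (i, k) $ (i, l))"

definition povm :: "nat \<Rightarrow> (nat \<Rightarrow> complex ^ 'n::finite ^ 'n) \<Rightarrow> bool" where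
  "povm d M \<longleftrightarrow> (\<forall>a<d. psd (M a)) \<and> (\<Sum>a<d. M a) = mat 1"

text \<open>
  Families of operators labelled by an outcome \<open>a\<close> and a setting \<open>x\<close> are functions with the
  outcome first, so \<open>M a x\<close> is $M_{a|x}$. With \<open>d\<close> outcomes and \<open>m\<close> settings, only the values for
  \<open>a < d\<close> and \<open>x \<in> {1..m}\<close> are relevant.
\<close>

definition assemblage ::
  "complex ^ ('a::finite \<times> 'b::finite) ^ ('a \<times> 'b) \<Rightarrow> (nat \<Rightarrow> nat \<Rightarrow> complex ^ 'a ^ 'a)
     \<Rightarrow> nat \<Rightarrow> nat \<Rightarrow> complex ^ 'b ^ 'b" where
  "assemblage \<rho> M a x = partial_trace_A (tensor_op (M a x) (mat 1) ** \<rho>)"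

text \<open>
  The hidden variable \<open>\<lambda>\<close> ranges over a finite set, enumerated as \<open>{..<n}\<close>.
  Traces of positive semidefinite operators are real, so \<open>Re\<close> only changes the type.
\<close>

definition admits_LHS ::
  "nat \<Rightarrow> nat \<Rightarrow> (nat \<Rightarrow> nat \<Rightarrow> complex ^ 'b::finite ^ 'b) \<Rightarrow> bool" where
  "admits_LHS d m \<sigma> \<longleftrightarrow>
     (\<exists>(n::nat) (p :: nat \<Rightarrow> nat \<Rightarrow> nat \<Rightarrow> real) (\<tau> :: nat \<Rightarrow> complex ^ 'b ^ 'b).
        (\<forall>x\<in>{1..m}. \<forall>l<n. (\<forall>a<d. 0 \<le> p a x l) \<and> (\<Sum>a<d. p a x l) = 1) \<and>
        (\<forall>l<n. psd (\<tau> l)) \<and> (\<Sum>l<n. Re (trace (\<tau> l))) = 1 \<and>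
        (\<forall>a<d. \<forall>x\<in>{1..m}. \<sigma> a x = (\<Sum>l<n. p a x l *\<^sub>R \<tau> l)))"

text \<open>
  In \<open>\<sigma> e a x\<close> the first argument is the eavesdropper's guess, so \<open>\<sigma> e a x\<close> is
  $\sigma^e_{a|x}$.
\<close>

definition guessing_feasible ::
  "nat \<Rightarrow> nat \<Rightarrow> (nat \<Rightarrow> nat \<Rightarrow> complex ^ 'b::finite ^ 'b)
     \<Rightarrow> (nat \<Rightarrow> nat \<Rightarrow> nat \<Rightarrow> complex ^ 'b ^ 'b) \<Rightarrow> bool" where
  "guessing_feasible d m \<sigma>obs \<sigma> \<longleftrightarrow>
     (\<forall>e<d. \<forall>a<d. \<forall>x\<in>{1..m}. psd (\<sigma> e a x)) \<and>
     (\<forall>a<d. \<forall>x\<in>{1..m}. (\<Sum>e<d. \<sigma> e a x) = \<sigma>obs a x) \<and>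
     (\<forall>e<d. \<forall>x\<in>{1..m}. \<forall>x'\<in>{1..m}. (\<Sum>a<d. \<sigma> e a x) = (\<Sum>a<d. \<sigma> e a x'))"

text \<open>
  For an assemblage arising from a state and POVMs, the values below form a nonempty bounded set
  and, the feasible families restricted to the relevant indices being compact, the supremum is
  attained; it is the maximum.
\<close>

definition P_guess ::
  "nat \<Rightarrow> nat \<Rightarrow> (nat \<Rightarrow> nat \<Rightarrow> complex ^ 'b::finite ^ 'b) \<Rightarrow> nat \<Rightarrow> real" where
  "P_guess d m \<sigma>obs xs =
     Sup {(\<Sum>e<d. Re (trace (\<sigma> e e xs))) | \<sigma>. guessing_feasible d m \<sigma>obs \<sigma>}"

definition certifies_steering_randomness ::
  "complex ^ ('a::finite \<times> 'b::finite) ^ ('a \<times> 'b) \<Rightarrow> bool" where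
  "certifies_steering_randomness \<rho> \<longleftrightarrow>
     (\<exists>(m::nat) (d::nat) (M :: nat \<Rightarrow> nat \<Rightarrow> complex ^ 'a ^ 'a) xs.
        1 \<le> m \<and> 1 \<le> d \<and> (\<forall>x\<in>{1..m}. povm d (\<lambda>a. M a x)) \<and> xs \<in> {1..m} \<and>
        P_guess d m (assemblage \<rho> M) xs < 1)"

definition steerable_with_two_settings ::
  "complex ^ ('a::finite \<times> 'b::finite) ^ ('a \<times> 'b) \<Rightarrow> bool" where
  "steerable_with_two_settings \<rho> \<longleftrightarrow>
     (\<exists>(d::nat) (M :: nat \<Rightarrow> nat \<Rightarrow> complex ^ 'a ^ 'a).
        (\<forall>x\<in>{1..2}. povm d (\<lambda>a. M a x)) \<and> \<not> admits_LHS d 2 (assemblage \<rho> M))"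

end

theory Submission
  imports Defs
begin

text \<open>
  Eve guesses the outcomes of setting \<open>x*\<close> perfectly iff the operators $\sigma^e_{a|x^*}$ with
  \<open>a \<noteq> e\<close> vanish. Then $\sum_a \sigma^e_{a|x} = \sigma^{obs}_{e|x^*}$ for every setting \<open>x\<close>, so
  $(e, a) \mapsto \sigma^e_{a|x}$ is a positive decomposition whose two marginals are the settings
  \<open>x*\<close> and \<open>x\<close> of the observed assemblage. Such a decomposition amounts to a local-hidden-state
  model for this pair of settings, with hidden variable \<open>(e, a)\<close> and deterministic responses. As the
  conditions for different \<open>x\<close> do not interact, perfect guessing for any number of settings
  follows from local-hidden-state models for all pairs \<open>(x*, x)\<close>, whereas two steerable settings
  already exclude it. Compactness of the set of Eve's strategies turns a supremum equal to 1 into a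
  perfect strategy.
\<close>

section \<open>Positive semidefinite matrices\<close>

lemma hermitian_diag: "hermitian M \<Longrightarrow> M $ i $ i = complex_of_real (Re (M $ i $ i))"
proof -
  assume "hermitian M"
  then have "cnj (M $ i $ i) = M $ i $ i" unfolding hermitian_def by metis
  then show ?thesis by (simp add: complex_eq_iff)
qed

lemma hermitian_cnj: "hermitian M \<Longrightarrow> cnj (M $ i $ j) = M $ j $ i"
  unfolding hermitian_def by metis

lemma psd_cnj: "psd M \<Longrightarrow> cnj (M $ i $ j) = M $ j $ i"
  by (simp add: psd_def hermitian_cnj)

lemma cnj_mult_self: "cnj z * z = complex_of_real ((cmod z)\<^sup>2)"
  by (metis complex_norm_square mult.commute)

text \<open>By hermiticity the two cross terms are complex conjugates and combine into one real
  part. The entry bounds and the Schur complement both arise from suitable choices of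
  \<open>v\<close> and \<open>c\<close>.\<close>

lemma hermitian_quadratic_form_shift:
  fixes M :: "complex ^ 'n::finite ^ 'n"
  assumes "hermitian M"
  shows "Re (\<Sum>k\<in>UNIV. cnj ((v + axis i c) $ k) * (M *v (v + axis i c)) $ k) =
    Re (\<Sum>k\<in>UNIV. cnj (v $ k) * (M *v v) $ k) + 2 * Re (cnj c * (M *v v) $ i)
      + (cmod c)\<^sup>2 * Re (M $ i $ i)"
proof -
  have ax: "(M *v axis i c) $ k = M $ k $ i * c" for k
    by (simp add: matrix_vector_mult_def axis_def if_distrib cong: if_cong)
  have h: "cnj (M $ i $ k) = M $ k $ i" for k
    by (rule hermitian_cnj[OF assms])
  have "(\<Sum>k\<in>UNIV. cnj (v $ k) * M $ k $ i) = cnj ((M *v v) $ i)"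
    by (simp add: matrix_vector_mult_def h mult.commute)
  then have cr: "(\<Sum>k\<in>UNIV. cnj (v $ k) * (M $ k $ i * c)) = cnj ((M *v v) $ i) * c"
    by (metis (no_types, lifting) mult.assoc sum.cong sum_distrib_right)
  have "(\<Sum>k\<in>UNIV. cnj ((v + axis i c) $ k) * (M *v (v + axis i c)) $ k) =
     (\<Sum>k\<in>UNIV. cnj (v $ k) * (M *v v) $ k) + (\<Sum>k\<in>UNIV. cnj (v $ k) * (M $ k $ i * c))
     + (\<Sum>k\<in>UNIV. cnj (axis i c $ k) * ((M *v v) $ k + M $ k $ i * c))"
    by (simp add: matrix_vector_right_distrib ax algebra_simps sum.distrib)
  also have "(\<Sum>k\<in>UNIV. cnj (axis i c $ k) * ((M *v v) $ k + M $ k $ i * c))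
      = cnj c * ((M *v v) $ i + M $ i $ i * c)"
    by (subst sum.remove[of _ i]) (auto simp: axis_def intro!: sum.neutral)
  finally have "Re (\<Sum>k\<in>UNIV. cnj ((v + axis i c) $ k) * (M *v (v + axis i c)) $ k) =
    Re ((\<Sum>k\<in>UNIV. cnj (v $ k) * (M *v v) $ k)
      + cnj ((M *v v) $ i) * c + cnj c * ((M *v v) $ i + M $ i $ i * c))"
    unfolding cr by simp
  moreover have "M $ i $ i = complex_of_real (Re (M $ i $ i))"
    by (rule hermitian_diag[OF assms])
  then have "Im (M $ i $ i) = 0" by (metis Im_complex_of_real)
  ultimately show ?thesis
    unfolding cmod_power2 by (simp add: algebra_simps power2_eq_square)
qed

lemma psd_quadratic_form:
  "psd M \<Longrightarrow> 0 \<le> Re (\<Sum>i\<in>UNIV. cnj (v $ i) * (M *v v) $ i)"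
  by (simp add: psd_def)

text \<open>The form is evaluated at \<open>axis j 1 + axis i c\<close>; the free coefficient
  \<open>c\<close> takes the place of two-by-two principal minors.\<close>

lemma psd_two_entries:
  fixes M :: "complex ^ 'n::finite ^ 'n"
  assumes "psd M"
  shows "0 \<le> Re (M $ j $ j) + 2 * Re (cnj c * M $ i $ j) + (cmod c)\<^sup>2 * Re (M $ i $ i)"
proof -
  have h: "hermitian M" using assms by (simp add: psd_def)
  have ax: "(M *v axis j 1) $ k = M $ k $ j" for k
    by (simp add: matrix_vector_mult_def axis_def if_distrib cong: if_cong)
  have ax': "axis j 1 $ k = (if k = j then 1 else (0::complex))" for k by (simp add: axis_def)
  have "(\<Sum>k\<in>UNIV. cnj (axis j 1 $ k) * (M *v axis j 1) $ k) = M $ j $ j"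
    by (subst sum.remove[of _ j]) (auto simp: ax ax' intro!: sum.neutral)
  then show ?thesis
    using psd_quadratic_form[OF assms, of "axis j 1 + axis i c"]
    unfolding hermitian_quadratic_form_shift[OF h] by (simp add: ax)
qed

lemma psd_diag_nonneg: "psd M \<Longrightarrow> 0 \<le> Re (M $ i $ i)"
  using psd_two_entries[of M i 0 i] by simp

lemma psd_trace_nonneg: "psd M \<Longrightarrow> 0 \<le> Re (trace M)"
  by (auto simp: trace_def intro!: sum_nonneg psd_diag_nonneg)

lemma psd_entry_le_trace:
  fixes M :: "complex ^ 'n::finite ^ 'n"
  assumes "psd M"
  shows "cmod (M $ i $ j) \<le> Re (trace M)"
proof -
  have d: "Re (M $ k $ k) \<le> Re (trace M)" for k
    unfolding trace_def Re_sum
    by (rule member_le_sum) (auto intro: psd_diag_nonneg[OF assms])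
  \<comment> \<open>The phase opposite to that of the entry (0 if the entry vanishes) makes the
    cross term as negative as possible, so twice the modulus of the entry is at most the sum of two
    diagonal entries.\<close>
  define c where "c = - sgn (M $ i $ j)"
  have "cnj c * M $ i $ j = - complex_of_real (cmod (M $ i $ j))"
    by (simp add: c_def sgn_eq cnj_mult_self power2_eq_square)
  then have "Re (cnj c * M $ i $ j) = - cmod (M $ i $ j)" by simp
  moreover have "(cmod c)\<^sup>2 * Re (M $ i $ i) \<le> 1 * Re (M $ i $ i)"
    by (rule mult_right_mono) (auto simp: c_def norm_sgn psd_diag_nonneg[OF assms])
  ultimately show ?thesis
    using psd_two_entries[OF assms, of j c i] d[of i] d[of j] by linarith
qed

lemma psd_trace_eq_0:
  assumes "psd M" "Re (trace M) = 0"
  shows "M = 0"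
  using psd_entry_le_trace[OF assms(1)] assms(2) by (simp add: vec_eq_iff)

text \<open>When \<open>M $ i $ i = 0\<close> the form is affine in the coefficient of
  \<open>axis i\<close>, so a nonzero \<open>M $ i $ j\<close> would make it unbounded
  below.\<close>

lemma psd_diag_eq_0:
  assumes "psd M" "M $ i $ i = 0"
  shows "M $ i $ j = 0"
proof (rule ccontr)
  assume nz: "M $ i $ j \<noteq> 0"
  \<comment> \<open>\<open>s\<close> makes the form equal to -1 at \<open>axis j 1 + axis i (- s * M $ i $ j)\<close>.\<close>
  define s where "s = (Re (M $ j $ j) + 1) / (2 * (cmod (M $ i $ j))\<^sup>2)"
  have "cnj (- (complex_of_real s * M $ i $ j)) * M $ i $ j
      = - complex_of_real (s * (cmod (M $ i $ j))\<^sup>2)"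
    by (simp add: mult.assoc cnj_mult_self)
  then have "Re (cnj (- (complex_of_real s * M $ i $ j)) * M $ i $ j) = - (s * (cmod (M $ i $ j))\<^sup>2)"
    by (metis Re_complex_of_real uminus_complex.simps(1))
  moreover have "2 * (s * (cmod (M $ i $ j))\<^sup>2) = Re (M $ j $ j) + 1"
    using nz by (simp add: s_def)
  ultimately show False
    using psd_two_entries[OF assms(1), of j "- (complex_of_real s * M $ i $ j)" i] assms(2)
    by simp
qed

section \<open>Schur complements and the trace pairing of two positive matrices\<close>

lemma psd_schur_complement:
  fixes M :: "complex ^ 'n::finite ^ 'n"
  assumes "psd M" "M $ i $ i \<noteq> 0"
  shows "psd (\<chi> k l. M $ k $ l - M $ k $ i * M $ i $ l / M $ i $ i)" (is "psd ?N")
  unfolding psd_def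
proof (intro conjI allI)
  have h: "hermitian M" using assms by (simp add: psd_def)
  obtain r where r: "M $ i $ i = complex_of_real r" using hermitian_diag[OF h] by metis
  have r0: "r > 0" using psd_diag_nonneg[OF assms(1), of i] assms(2) r by (auto simp: less_le)
  have hc: "cnj (M $ k $ l) = M $ l $ k" for k l by (rule hermitian_cnj[OF h])
  show "hermitian ?N" unfolding hermitian_def by (simp add: hc mult.commute)
  fix v :: "complex ^ 'n"
  \<comment> \<open>\<open>?N\<close> at \<open>v\<close> is the minimum of the form of \<open>M\<close> over \<open>v + axis i c\<close>, attained at this \<open>c\<close>.\<close>
  define z where "z = (M *v v) $ i"
  define c where "c = - z / r"
  have Nv: "(?N *v v) $ k = (M *v v) $ k - M $ k $ i * z / r" for k
    by (simp add: matrix_vector_mult_def z_def r left_diff_distrib sum_subtractf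
        sum_distrib_left sum_divide_distrib mult.assoc)
  have "(\<Sum>k\<in>UNIV. cnj (v $ k) * M $ k $ i) = cnj z"
    by (simp add: z_def matrix_vector_mult_def hc mult.commute)
  moreover have "(\<Sum>k\<in>UNIV. cnj (v $ k) * (M $ k $ i * z / r))
      = (\<Sum>k\<in>UNIV. cnj (v $ k) * M $ k $ i) * (z / r)"
    unfolding sum_distrib_right by (intro sum.cong) simp_all
  ultimately have "(\<Sum>k\<in>UNIV. cnj (v $ k) * (M $ k $ i * z / r)) = cnj z * z / r"
    by simp
  also have "\<dots> = complex_of_real ((cmod z)\<^sup>2 / r)"
    by (simp add: cnj_mult_self)
  finally have "Re (\<Sum>k\<in>UNIV. cnj (v $ k) * (?N *v v) $ k) =
     Re (\<Sum>k\<in>UNIV. cnj (v $ k) * (M *v v) $ k) - (cmod z)\<^sup>2 / r"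
    by (simp add: Nv right_diff_distrib sum_subtractf)
  moreover have "Re (cnj c * z) = - ((cmod z)\<^sup>2 / r)"
  proof -
    have "cnj c * z = - complex_of_real ((cmod z)\<^sup>2 / r)"
      by (simp add: c_def cnj_mult_self)
    then show ?thesis by (simp del: of_real_divide)
  qed
  moreover have "(cmod c)\<^sup>2 * r = (cmod z)\<^sup>2 / r"
    using r0 by (simp add: c_def norm_divide power2_eq_square)
  ultimately show "0 \<le> Re (\<Sum>k\<in>UNIV. cnj (v $ k) * (?N *v v) $ k)"
    using psd_quadratic_form[OF assms(1), of "v + axis i c"]
    unfolding hermitian_quadratic_form_shift[OF h] z_def[symmetric] by (simp add: r)
qed

text \<open>
  Splitting off the rank-one part of a nonzero diagonal entry leaves the Schur complement, which has
  fewer nonzero diagonal entries.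
\<close>

lemma psd_trace_mult_nonneg:
  fixes M R :: "complex ^ 'n::finite ^ 'n"
  assumes "psd M" "psd R"
  shows "0 \<le> Re (\<Sum>k\<in>UNIV. \<Sum>l\<in>UNIV. M $ k $ l * R $ l $ k)"
  using assms(1)
proof (induction "card {i. M $ i $ i \<noteq> 0}" arbitrary: M rule: less_induct)
  case less
  show ?case
  proof (cases "\<exists>i. M $ i $ i \<noteq> 0")
    case False
    then have "M $ k $ l = 0" for k l using psd_diag_eq_0[OF less.prems] by auto
    then show ?thesis by simp
  next
    case True
    then obtain i where i: "M $ i $ i \<noteq> 0" by blast
    define N :: "complex ^ 'n ^ 'n" where "N = (\<chi> k l. M $ k $ l - M $ k $ i * M $ i $ l / M $ i $ i)"
    have "psd N" unfolding N_def by (rule psd_schur_complement[OF less.prems i])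
    have h: "hermitian M" using less.prems by (simp add: psd_def)
    obtain r where r: "M $ i $ i = complex_of_real r" using hermitian_diag[OF h] by metis
    have r0: "r > 0" using psd_diag_nonneg[OF less.prems, of i] i r by (auto simp: less_le)
    have hc: "cnj (M $ k $ i) = M $ i $ k" for k by (rule hermitian_cnj[OF h])
    \<comment> \<open>A zero diagonal entry of \<open>M\<close> forces a zero row, so it stays zero
      in \<open>N\<close>; entry \<open>i\<close> becomes zero as well, and the induction measure
      drops.\<close>
    have "M $ k $ k = 0 \<Longrightarrow> N $ k $ k = 0" for k
      using psd_diag_eq_0[OF less.prems, of k i] by (simp add: N_def)
    moreover have "N $ i $ i = 0" using i by (simp add: N_def)
    ultimately have "{k. N $ k $ k \<noteq> 0} \<subset> {k. M $ k $ k \<noteq> 0}" using i by blast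
    then have "card {k. N $ k $ k \<noteq> 0} < card {k. M $ k $ k \<noteq> 0}"
      by (intro psubset_card_mono) auto
    from less.hyps[OF this \<open>psd N\<close>]
    have N0: "0 \<le> Re (\<Sum>k\<in>UNIV. \<Sum>l\<in>UNIV. N $ k $ l * R $ l $ k)" .
    \<comment> \<open>The part split off from \<open>M\<close> is \<open>m\<close> times its
      adjoint, divided by \<open>r\<close>; its pairing with \<open>R\<close> is therefore the form
      of \<open>R\<close> at \<open>m\<close> divided by \<open>r\<close>.\<close>
    define m where "m = (\<chi> k. M $ k $ i)"
    have "(\<Sum>k\<in>UNIV. \<Sum>l\<in>UNIV. M $ k $ i * M $ i $ l / M $ i $ i * R $ l $ k) =
       (\<Sum>l\<in>UNIV. cnj (m $ l) * (R *v m) $ l) / r"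
      unfolding sum_divide_distrib matrix_vector_mult_def
      by (subst sum.swap) (simp add: m_def hc r sum_distrib_left sum_divide_distrib mult_ac)
    then have "(\<Sum>k\<in>UNIV. \<Sum>l\<in>UNIV. M $ k $ l * R $ l $ k) =
       (\<Sum>k\<in>UNIV. \<Sum>l\<in>UNIV. N $ k $ l * R $ l $ k) + (\<Sum>l\<in>UNIV. cnj (m $ l) * (R *v m) $ l) / r"
      by (simp add: N_def left_diff_distrib sum_subtractf)
    then show ?thesis
      using N0 psd_quadratic_form[OF assms(2), of m] r0 by simp
  qed
qed

section \<open>The cone of positive matrices: sums, norm bound, closedness\<close>

lemma psd_zero: "psd (0 :: complex ^ 'n::finite ^ 'n)"
  by (simp add: psd_def hermitian_def)

lemma psd_add:
  fixes M N :: "complex ^ 'n::finite ^ 'n"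
  assumes "psd M" "psd N"
  shows "psd (M + N)"
  unfolding psd_def
proof (intro conjI allI)
  show "hermitian (M + N)"
    unfolding hermitian_def by (simp add: psd_cnj[OF assms(1)] psd_cnj[OF assms(2)])
  fix v :: "complex ^ 'n"
  show "0 \<le> Re (\<Sum>i\<in>UNIV. cnj (v $ i) * ((M + N) *v v) $ i)"
    using psd_quadratic_form[OF assms(1), of v] psd_quadratic_form[OF assms(2), of v]
    by (simp add: matrix_vector_mult_add_rdistrib distrib_left sum.distrib)
qed

lemma psd_scaleR:
  fixes M :: "complex ^ 'n::finite ^ 'n"
  assumes "psd M" "0 \<le> r"
  shows "psd (r *\<^sub>R M)"
  unfolding psd_def
proof (intro conjI allI)
  show "hermitian (r *\<^sub>R M)" unfolding hermitian_def
    by (simp add: psd_cnj[OF assms(1)])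
  fix v :: "complex ^ 'n"
  have "(\<Sum>i\<in>UNIV. cnj (v $ i) * ((r *\<^sub>R M) *v v) $ i) = r *\<^sub>R (\<Sum>i\<in>UNIV. cnj (v $ i) * (M *v v) $ i)"
    by (simp add: matrix_vector_mult_def flip: scaleR_sum_right)
  then show "0 \<le> Re (\<Sum>i\<in>UNIV. cnj (v $ i) * ((r *\<^sub>R M) *v v) $ i)"
    using psd_quadratic_form[OF assms(1), of v] assms(2) by simp
qed

lemma psd_sum: "(\<And>i. i \<in> A \<Longrightarrow> psd (f i)) \<Longrightarrow> psd (\<Sum>i\<in>A. f i)"
  by (induction A rule: infinite_finite_induct) (auto intro: psd_zero psd_add)

lemma Re_trace_sum: "Re (trace (\<Sum>i\<in>A. f i)) = (\<Sum>i\<in>A. Re (trace (f i :: complex ^ 'n::finite ^ 'n)))"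
  by (simp add: trace_def) (rule sum.swap)

text \<open>Every entry is bounded by the trace. The constant is crude: it only serves to confine
  positive matrices of bounded trace to a ball.\<close>

lemma psd_norm_le:
  fixes M :: "complex ^ 'n::finite ^ 'n"
  assumes "psd M"
  shows "norm M \<le> real (CARD('n) * CARD('n)) * Re (trace M)"
proof -
  have "norm M \<le> (\<Sum>i\<in>UNIV. norm (M $ i))"
    unfolding norm_vec_def[of M] by (rule L2_set_le_sum) simp
  also have "\<dots> \<le> (\<Sum>i\<in>UNIV. \<Sum>j\<in>UNIV. cmod (M $ i $ j))"
    unfolding norm_vec_def[of "M $ i" for i] by (intro sum_mono L2_set_le_sum) simp
  also have "\<dots> \<le> (\<Sum>i\<in>(UNIV::'n set). \<Sum>j\<in>(UNIV::'n set). Re (trace M))"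
    by (intro sum_mono psd_entry_le_trace assms)
  finally show ?thesis by (simp add: mult.assoc)
qed

lemma closed_psd: "closed {M :: complex ^ 'n::finite ^ 'n. psd M}"
  unfolding psd_def hermitian_def matrix_vector_mult_def
  by (intro closed_Collect_conj closed_Collect_all closed_Collect_eq closed_Collect_le
      continuous_intros) 

section \<open>Optimal guessing strategies\<close>

text \<open>Tychonoff's theorem, transferred from the abstract product topology to the topology of
  the function type.\<close>

lemma compact_PiE_UNIV:
  fixes K :: "'i \<Rightarrow> 'x::topological_space set"
  assumes "\<And>i. compact (K i)"
  shows "compact (Pi\<^sub>E UNIV K)"
proof -
  have "compactin (product_topology (\<lambda>i. euclidean) UNIV) (Pi\<^sub>E UNIV K)"
    using assms by (simp add: compactin_PiE compactin_euclidean_iff)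
  then show ?thesis by (simp add: euclidean_product_topology compactin_euclidean_iff)
qed

text \<open>Strategies are uncurried to functions of one index triple, so that each constraint is a
  closed condition on finitely many coordinates of a product space.\<close>

lemma closed_guessing_feasible:
  "closed {f. guessing_feasible d m \<sigma>obs (\<lambda>e a x. f (e, a, x) :: complex ^ 'b::finite ^ 'b)}"
proof -
  have "closed {f :: nat \<times> nat \<times> nat \<Rightarrow> complex ^ 'b ^ 'b. psd (f p)}" for p
    using closed_vimage[OF closed_psd continuous_on_product_coordinates] by (simp add: vimage_def)
  then show ?thesis
    unfolding guessing_feasible_def Ball_def
    by (intro closed_Collect_conj closed_Collect_all closed_Collect_imp open_Collect_const
        closed_Collect_eq continuous_intros continuous_on_product_coordinates) 
qed

text \<open>Isolates the properties inherited from a state and POVMs, so that the existence of an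
  optimal strategy can be shown without reference to the state.\<close>

definition normalized_assemblage ::
  "nat \<Rightarrow> nat \<Rightarrow> (nat \<Rightarrow> nat \<Rightarrow> complex ^ 'b::finite ^ 'b) \<Rightarrow> bool" where
  "normalized_assemblage d m \<sigma> \<longleftrightarrow>
     (\<forall>a<d. \<forall>x\<in>{1..m}. psd (\<sigma> a x)) \<and>
     (\<forall>x\<in>{1..m}. \<forall>x'\<in>{1..m}. (\<Sum>a<d. \<sigma> a x) = (\<Sum>a<d. \<sigma> a x')) \<and>
     (\<forall>x\<in>{1..m}. (\<Sum>a<d. Re (trace (\<sigma> a x))) = 1)"

lemma normalized_assemblageD:
  assumes "normalized_assemblage d m \<sigma>"
  shows "a < d \<Longrightarrow> x \<in> {1..m} \<Longrightarrow> psd (\<sigma> a x)"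
    and "x \<in> {1..m} \<Longrightarrow> x' \<in> {1..m} \<Longrightarrow> (\<Sum>a<d. \<sigma> a x) = (\<Sum>a<d. \<sigma> a x')"
    and "x \<in> {1..m} \<Longrightarrow> (\<Sum>a<d. Re (trace (\<sigma> a x))) = 1"
  using assms unfolding normalized_assemblage_def by blast+

lemma guessing_feasibleD:
  assumes "guessing_feasible d m \<sigma>obs \<sigma>"
  shows "e < d \<Longrightarrow> a < d \<Longrightarrow> x \<in> {1..m} \<Longrightarrow> psd (\<sigma> e a x)"
    and "a < d \<Longrightarrow> x \<in> {1..m} \<Longrightarrow> (\<Sum>e<d. \<sigma> e a x) = \<sigma>obs a x"
    and "e < d \<Longrightarrow> x \<in> {1..m} \<Longrightarrow> x' \<in> {1..m} \<Longrightarrow> (\<Sum>a<d. \<sigma> e a x) = (\<Sum>a<d. \<sigma> e a x')"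
  using assms unfolding guessing_feasible_def by blast+

lemma guessing_feasible_trace:
  assumes "guessing_feasible d m \<sigma>obs \<sigma>" "x \<in> {1..m}"
  shows "(\<Sum>e<d. \<Sum>a<d. Re (trace (\<sigma> e a x))) = (\<Sum>a<d. Re (trace (\<sigma>obs a x)))"
proof -
  have "(\<Sum>e<d. Re (trace (\<sigma> e a x))) = Re (trace (\<sigma>obs a x))" if "a < d" for a
    unfolding Re_trace_sum[symmetric] guessing_feasibleD(2)[OF assms(1) that assms(2)] ..
  then show ?thesis by (subst sum.swap) simp
qed

text \<open>Wrong guesses contribute nonnegative traces. This provides the upper bound that makes
  the supremum in \<open>P_guess\<close> meaningful.\<close>

lemma guessing_value_le:
  assumes "guessing_feasible d m \<sigma>obs \<sigma>" "x \<in> {1..m}"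
  shows "(\<Sum>e<d. Re (trace (\<sigma> e e x))) \<le> (\<Sum>a<d. Re (trace (\<sigma>obs a x)))"
  unfolding guessing_feasible_trace[OF assms, symmetric]
proof (intro sum_mono)
  fix e assume "e \<in> {..<d}"
  then show "Re (trace (\<sigma> e e x)) \<le> (\<Sum>a<d. Re (trace (\<sigma> e a x)))"
    using assms(2) by (intro member_le_sum) (auto intro!: psd_trace_nonneg guessing_feasibleD(1)[OF assms(1)])
qed

text \<open>Eve holds no side information and always guesses outcome 0; hence the set of guessing
  values is nonempty.\<close>

lemma guessing_feasible_trivial:
  assumes "normalized_assemblage d m \<sigma>obs"
  shows "guessing_feasible d m \<sigma>obs (\<lambda>e a x. if e = 0 then \<sigma>obs a x else 0)"
  unfolding guessing_feasible_def
proof (intro conjI allI ballI impI)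
  fix e a x assume "e < d" "a < d" "x \<in> {1..m}"
  then show "psd (if e = 0 then \<sigma>obs a x else 0)"
    using normalized_assemblageD(1)[OF assms] by (simp add: psd_zero)
next
  fix a x assume "a < d"
  \<comment> \<open>The bound \<open>a < d\<close> ensures that the guess 0 lies in the summation
    range.\<close>
  then show "(\<Sum>e<d. if e = 0 then \<sigma>obs a x else 0) = \<sigma>obs a x" by simp
next
  fix e x x' assume "x \<in> {1..m}" "x' \<in> {1..m}"
  then have "(\<Sum>a<d. \<sigma>obs a x) = (\<Sum>a<d. \<sigma>obs a x')"
    by (rule normalized_assemblageD(2)[OF assms])
  then show "(\<Sum>a<d. if e = 0 then \<sigma>obs a x else 0) = (\<Sum>a<d. if e = 0 then \<sigma>obs a x' else 0)"
    by (cases "e = 0") simp_all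
qed

text \<open>Extreme value theorem on a compact set of strategies. The stated inequality suffices to
  extract a perfect strategy from a supremum of at least 1.\<close>

lemma P_guess_attained:
  fixes \<sigma>obs :: "nat \<Rightarrow> nat \<Rightarrow> complex ^ 'b::finite ^ 'b"
  assumes na: "normalized_assemblage d m \<sigma>obs" and xs: "xs \<in> {1..m}"
  obtains \<sigma> where "guessing_feasible d m \<sigma>obs \<sigma>"
    "P_guess d m \<sigma>obs xs \<le> (\<Sum>e<d. Re (trace (\<sigma> e e xs)))"
proof -
  define B where "B = real (CARD('b) * CARD('b))"
  define F where "F = (\<Pi>\<^sub>E p\<in>UNIV. cball 0 B) \<inter>
    {f :: nat \<times> nat \<times> nat \<Rightarrow> complex ^ 'b ^ 'b. guessing_feasible d m \<sigma>obs (\<lambda>e a x. f (e, a, x))}"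
  define g where "g f = (\<Sum>e<d. Re (trace (f (e, e, xs))))" for f :: "nat \<times> nat \<times> nat \<Rightarrow> complex ^ 'b ^ 'b"
  \<comment> \<open>Values outside the index ranges are unconstrained, so feasible strategies are
    not bounded as functions. Resetting those values to 0 preserves feasibility and the guessing
    value, and lands in a product of balls.\<close>
  have cutoff: "\<exists>f\<in>F. g f = (\<Sum>e<d. Re (trace (\<sigma> e e xs)))" if feas: "guessing_feasible d m \<sigma>obs \<sigma>" for \<sigma>
  proof (intro bexI)
    let ?f = "\<lambda>(e, a, x). if e < d \<and> a < d \<and> x \<in> {1..m} then \<sigma> e a x else 0"
    show "g ?f = (\<Sum>e<d. Re (trace (\<sigma> e e xs)))" using xs by (simp add: g_def)
    have "norm (\<sigma> e a x) \<le> B" if i: "e < d" "a < d" "x \<in> {1..m}" for e a x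
    proof -
      have p: "psd (\<sigma> e' a' x)" if "e' < d" "a' < d" for e' a'
        by (rule guessing_feasibleD(1)[OF feas that i(3)])
      \<comment> \<open>The nonnegative traces over all guesses and outcomes add up to 1, so no
        single one exceeds 1.\<close>
      have "Re (trace (\<sigma> e a x)) \<le> (\<Sum>a<d. Re (trace (\<sigma> e a x)))"
        using i p by (intro member_le_sum) (auto intro: psd_trace_nonneg)
      also have "\<dots> \<le> (\<Sum>e<d. \<Sum>a<d. Re (trace (\<sigma> e a x)))"
        using i p by (intro member_le_sum[of e _ "\<lambda>e. \<Sum>a<d. Re (trace (\<sigma> e a x))"])
          (auto intro!: sum_nonneg psd_trace_nonneg)
      also have "\<dots> = 1"
        using guessing_feasible_trace[OF feas i(3)] normalized_assemblageD(3)[OF na i(3)] by simp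
      finally have "B * Re (trace (\<sigma> e a x)) \<le> B * 1"
        by (intro mult_left_mono) (simp_all add: B_def)
      then show ?thesis using psd_norm_le[OF p[OF i(1,2)], folded B_def] by simp
    qed
    moreover have "0 \<le> B" by (simp add: B_def)
    ultimately have "?f \<in> (\<Pi>\<^sub>E p\<in>UNIV. cball 0 B)" by auto
    moreover have "guessing_feasible d m \<sigma>obs (\<lambda>e a x. ?f (e, a, x))"
      unfolding guessing_feasible_def
    proof (intro conjI allI ballI impI)
      fix e x x' assume i: "e < d" "x \<in> {1..m}" "x' \<in> {1..m}"
      show "(\<Sum>a<d. ?f (e, a, x)) = (\<Sum>a<d. ?f (e, a, x'))"
        using guessing_feasibleD(3)[OF feas i] i by simp
    qed (use guessing_feasibleD(1,2)[OF feas] in auto)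
    ultimately show "?f \<in> F" by (simp add: F_def)
  qed
  have "compact F"
    unfolding F_def by (intro compact_Int_closed compact_PiE_UNIV closed_guessing_feasible compact_cball)
  moreover have "F \<noteq> {}"
    using cutoff[OF guessing_feasible_trivial[OF na]] by blast
  moreover have "continuous_on F g"
    unfolding g_def trace_def
    by (intro continuous_intros continuous_on_subset[OF continuous_on_product_coordinates subset_UNIV])
  ultimately have "\<exists>f\<in>F. \<forall>f'\<in>F. g f' \<le> g f"
    by (rule continuous_attains_sup)
  then obtain f where f: "f \<in> F" "\<And>f'. f' \<in> F \<Longrightarrow> g f' \<le> g f"
    by blast
  show ?thesis
  proof (rule that)
    show "guessing_feasible d m \<sigma>obs (\<lambda>e a x. f (e, a, x))" using f(1) by (simp add: F_def)
    have "P_guess d m \<sigma>obs xs \<le> g f"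
      unfolding P_guess_def
    proof (rule cSup_least)
      show "{(\<Sum>e<d. Re (trace (\<sigma> e e xs))) | \<sigma>. guessing_feasible d m \<sigma>obs \<sigma>} \<noteq> {}"
        using guessing_feasible_trivial[OF na] by blast
      fix r assume "r \<in> {(\<Sum>e<d. Re (trace (\<sigma> e e xs))) | \<sigma>. guessing_feasible d m \<sigma>obs \<sigma>}"
      then obtain \<sigma> where "guessing_feasible d m \<sigma>obs \<sigma>" and "r = (\<Sum>e<d. Re (trace (\<sigma> e e xs)))"
        by blast
      then obtain f' where "f' \<in> F" "r = g f'" using cutoff by metis
      then show "r \<le> g f" using f(2) by simp
    qed
    then show "P_guess d m \<sigma>obs xs \<le> (\<Sum>e<d. Re (trace (f (e, e, xs))))" by (simp add: g_def)
  qed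
qed

section \<open>Two-setting local-hidden-state models\<close>

text \<open>An operator-valued coupling of \<alpha> and \<beta>, the analogue of a joint
  distribution with prescribed marginals.\<close>

definition joint_decomposition ::
  "nat \<Rightarrow> (nat \<Rightarrow> complex ^ 'b::finite ^ 'b) \<Rightarrow> (nat \<Rightarrow> complex ^ 'b ^ 'b)
     \<Rightarrow> (nat \<Rightarrow> nat \<Rightarrow> complex ^ 'b ^ 'b) \<Rightarrow> bool" where
  "joint_decomposition d \<alpha> \<beta> G \<longleftrightarrow>
     (\<forall>e<d. \<forall>a<d. psd (G e a)) \<and> (\<forall>e<d. (\<Sum>a<d. G e a) = \<alpha> e) \<and> (\<forall>a<d. (\<Sum>e<d. G e a) = \<beta> a)"

text \<open>The pair \<open>(e, a)\<close> is encoded as \<open>e * d + a\<close>, because hidden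
  variables are enumerated by natural numbers.\<close>

lemma sum_div_mod:
  fixes f :: "nat \<Rightarrow> nat \<Rightarrow> 'c::comm_monoid_add"
  assumes "0 < d"
  shows "(\<Sum>l<n * d. f (l div d) (l mod d)) = (\<Sum>e<n. \<Sum>a<d. f e a)"
proof -
  have "(\<Sum>l = e * d..<e * d + d. f (l div d) (l mod d)) = (\<Sum>a<d. f e a)" for e
    using assms by (simp add: sum.atLeastLessThan_shift_0[of _ "e * d"] atLeast0LessThan)
  then show ?thesis by (simp flip: sum.nat_group)
qed

lemma admits_LHS_2_if_joint_decomposition:
  fixes \<sigma> :: "nat \<Rightarrow> nat \<Rightarrow> complex ^ 'b::finite ^ 'b"
  assumes G: "joint_decomposition d (\<lambda>e. \<sigma> e 1) (\<lambda>a. \<sigma> a 2) G"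
    and tr: "(\<Sum>a<d. Re (trace (\<sigma> a 1))) = 1"
  shows "admits_LHS d 2 \<sigma>"
proof -
  \<comment> \<open>The unit trace excludes \<open>d = 0\<close>, where \<open>div\<close> and
    \<open>mod\<close> would not decode pairs.\<close>
  have d: "0 < d" using tr by (cases d) auto
  define p :: "nat \<Rightarrow> nat \<Rightarrow> nat \<Rightarrow> real" where
    "p a x l = (if a = (if x = 1 then l div d else l mod d) then 1 else 0)" for a x l
  define \<tau> where "\<tau> l = G (l div d) (l mod d)" for l
  have x: "x \<in> {1..2} \<longleftrightarrow> x = 1 \<or> x = 2" for x :: nat by auto
  have l: "l div d < d" "l mod d < d" if "l < d * d" for l
    using that d by (simp_all add: less_mult_imp_div_less)
  have "(\<Sum>a<d. p a x l) = 1" if "l < d * d" for x l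
    using l[OF that] by (simp add: p_def)
  moreover have "psd (\<tau> l)" if "l < d * d" for l
    using l[OF that] G by (simp add: \<tau>_def joint_decomposition_def)
  moreover have "(\<Sum>l<d * d. Re (trace (\<tau> l))) = 1"
  proof -
    have "(\<Sum>l<d * d. Re (trace (\<tau> l))) = (\<Sum>e<d. \<Sum>a<d. Re (trace (G e a)))"
      unfolding \<tau>_def by (rule sum_div_mod[OF d])
    also have "\<dots> = (\<Sum>e<d. Re (trace (\<sigma> e 1)))"
      using G by (simp add: joint_decomposition_def flip: Re_trace_sum)
    finally show ?thesis using tr by simp
  qed
  moreover have "\<sigma> a x = (\<Sum>l<d * d. p a x l *\<^sub>R \<tau> l)" if "a < d" "x \<in> {1..2}" for a x
  proof (cases "x = 1")
    case True
    have "(\<Sum>l<d * d. p a x l *\<^sub>R \<tau> l) = (\<Sum>e<d. \<Sum>b<d. (if a = e then 1 else 0) *\<^sub>R G e b)"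
      unfolding \<tau>_def p_def
      using True sum_div_mod[OF d, of "\<lambda>e b. (if a = e then 1 else 0) *\<^sub>R G e b" d]
      by simp
    also have "\<dots> = (\<Sum>b<d. G a b)"
      using that by (subst sum.swap) (simp add: if_distrib[of "\<lambda>c. c *\<^sub>R _"] cong: if_cong)
    finally show ?thesis using G that True by (simp add: joint_decomposition_def)
  next
    case False
    have "(\<Sum>l<d * d. p a x l *\<^sub>R \<tau> l) = (\<Sum>e<d. \<Sum>b<d. (if a = b then 1 else 0) *\<^sub>R G e b)"
      unfolding \<tau>_def p_def
      using False sum_div_mod[OF d, of "\<lambda>e b. (if a = b then 1 else 0) *\<^sub>R G e b" d]
      by simp
    also have "\<dots> = (\<Sum>e<d. G e a)"
      using that by (simp add: if_distrib[of "\<lambda>c. c *\<^sub>R _"] cong: if_cong)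
    finally show ?thesis using G that False x by (simp add: joint_decomposition_def)
  qed
  ultimately show ?thesis
    unfolding admits_LHS_def
    by (intro exI[of _ "d * d"] exI[of _ p] exI[of _ \<tau>]) (simp add: p_def)
qed

lemma joint_decomposition_if_admits_LHS_2:
  fixes \<sigma> :: "nat \<Rightarrow> nat \<Rightarrow> complex ^ 'b::finite ^ 'b"
  assumes "admits_LHS d 2 \<sigma>"
  obtains G where "joint_decomposition d (\<lambda>e. \<sigma> e 1) (\<lambda>a. \<sigma> a 2) G"
proof -
  obtain n p \<tau> where
    resp: "\<forall>x\<in>{1..2}. \<forall>l<n. (\<forall>a<d. 0 \<le> p a x l) \<and> (\<Sum>a<d. p a x l) = (1::real)"
    and pos: "\<forall>l<n. psd (\<tau> l)"
    and model: "\<forall>a<d. \<forall>x\<in>{1..2}. \<sigma> a x = (\<Sum>l<n::nat. p a x l *\<^sub>R \<tau> l)"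
    using assms unfolding admits_LHS_def by (elim exE conjE) (rule that)
  have p: "0 \<le> p a x l" if "x \<in> {1..2}" "l < n" "a < d" for x l a
    using resp that by blast
  have p1: "(\<Sum>a<d. p a x l) = 1" if "x \<in> {1..2}" "l < n" for x l
    using resp that by blast
  have \<tau>: "psd (\<tau> l)" if "l < n" for l
    using pos that by blast
  have \<sigma>: "\<sigma> a x = (\<Sum>l<n. p a x l *\<^sub>R \<tau> l)" if "a < d" "x \<in> {1..2}" for a x
    using model that by blast
  \<comment> \<open>Given the hidden variable, the responses to the two settings are drawn
    independently; summing one of them out leaves the model of the other setting.\<close>
  define G where "G e a = (\<Sum>l<n. (p e 1 l * p a 2 l) *\<^sub>R \<tau> l)" for e a
  have "psd (G e a)" if "e < d" "a < d" for e a
    unfolding G_def using that by (intro psd_sum psd_scaleR \<tau> mult_nonneg_nonneg p) auto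
  moreover have "(\<Sum>a<d. G e a) = \<sigma> e 1" if "e < d" for e
  proof -
    have "(\<Sum>a<d. G e a) = (\<Sum>l<n. (p e 1 l * (\<Sum>a<d. p a 2 l)) *\<^sub>R \<tau> l)"
      unfolding G_def sum_distrib_left scaleR_sum_left by (rule sum.swap)
    also have "\<dots> = (\<Sum>l<n. p e 1 l *\<^sub>R \<tau> l)" by (simp add: p1)
    finally show ?thesis using \<sigma>[OF that] by simp
  qed
  moreover have "(\<Sum>e<d. G e a) = \<sigma> a 2" if "a < d" for a
  proof -
    have "(\<Sum>e<d. G e a) = (\<Sum>l<n. ((\<Sum>e<d. p e 1 l) * p a 2 l) *\<^sub>R \<tau> l)"
      unfolding G_def sum_distrib_right scaleR_sum_left by (rule sum.swap)
    also have "\<dots> = (\<Sum>l<n. p a 2 l *\<^sub>R \<tau> l)" by (simp add: p1)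
    finally show ?thesis using \<sigma>[OF that] by simp
  qed
  ultimately have "joint_decomposition d (\<lambda>e. \<sigma> e 1) (\<lambda>a. \<sigma> a 2) G"
    by (simp add: joint_decomposition_def)
  then show ?thesis by (rule that)
qed

section \<open>Perfect guessing strategies and couplings of settings\<close>

lemma joint_decomposition_if_perfect_guess:
  assumes feas: "guessing_feasible d m \<sigma>obs \<sigma>" and xs: "xs \<in> {1..m}" and x: "x \<in> {1..m}"
    and perfect: "(\<Sum>a<d. Re (trace (\<sigma>obs a xs))) \<le> (\<Sum>e<d. Re (trace (\<sigma> e e xs)))"
  shows "joint_decomposition d (\<lambda>e. \<sigma>obs e xs) (\<lambda>a. \<sigma>obs a x) (\<lambda>e a. \<sigma> e a x)"
proof -
  have p: "psd (\<sigma> e a xs)" if "e < d" "a < d" for e a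
    by (rule guessing_feasibleD(1)[OF feas that xs])
  let ?t = "\<lambda>e a. Re (trace (\<sigma> e a xs))"
  have "(\<Sum>a<d. ?t e a) = ?t e e + (\<Sum>a\<in>{..<d} - {e}. ?t e a)" if "e < d" for e
    using that by (subst sum.remove[of _ e]) auto
  \<comment> \<open>The total trace splits into correct and wrong guesses. Perfection makes the
    wrong part at most 0, and since its terms are nonnegative, each vanishes.\<close>
  then have "(\<Sum>e<d. \<Sum>a<d. ?t e a) = (\<Sum>e<d. ?t e e) + (\<Sum>e<d. \<Sum>a\<in>{..<d} - {e}. ?t e a)"
    by (simp flip: sum.distrib)
  then have le: "(\<Sum>e<d. \<Sum>a\<in>{..<d} - {e}. ?t e a) \<le> 0"
    using perfect guessing_feasible_trace[OF feas xs] by linarith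
  have nn: "0 \<le> ?t e a" if "e < d" "a < d" for e a
    by (rule psd_trace_nonneg[OF p[OF that]])
  then have nn': "0 \<le> (\<Sum>a\<in>{..<d} - {e}. ?t e a)" if "e < d" for e
    using that by (intro sum_nonneg) auto
  have "(\<Sum>e<d. \<Sum>a\<in>{..<d} - {e}. ?t e a) = 0"
    by (intro antisym le, rule sum_nonneg) (simp add: nn')
  then have "(\<Sum>a\<in>{..<d} - {e}. ?t e a) = 0" if "e < d" for e
    using sum_nonneg_0[of "{..<d}" "\<lambda>e. \<Sum>a\<in>{..<d} - {e}. ?t e a" e] nn' that by simp
  then have t0: "?t e a = 0" if "e < d" "a < d" "a \<noteq> e" for e a
    using sum_nonneg_0[of "{..<d} - {e}" "?t e" a] nn that by simp
  have z: "\<sigma> e a xs = 0" if "e < d" "a < d" "a \<noteq> e" for e a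
    using psd_trace_eq_0[OF p[OF that(1,2)] t0[OF that]] .
  have "(\<Sum>a<d. \<sigma> e a x) = \<sigma>obs e xs" if "e < d" for e
  proof -
    \<comment> \<open>Eve's no-signalling condition moves the sum from \<open>x\<close> to
      \<open>xs\<close>, where only one term survives, both in the sum over outcomes and in the sum
      over guesses.\<close>
    have "(\<Sum>a<d. \<sigma> e a x) = (\<Sum>a<d. \<sigma> e a xs)"
      by (rule guessing_feasibleD(3)[OF feas that x xs])
    also have "\<dots> = \<sigma> e e xs" using that z by (subst sum.remove[of _ e]) auto
    also have "\<dots> = (\<Sum>e'<d. \<sigma> e' e xs)" using that z by (subst sum.remove[of _ e]) auto
    also have "\<dots> = \<sigma>obs e xs" by (rule guessing_feasibleD(2)[OF feas that xs])
    finally show ?thesis .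
  qed
  then show ?thesis
    using guessing_feasibleD(1,2)[OF feas] x by (simp add: joint_decomposition_def)
qed

text \<open>The couplings of \<open>xs\<close> with each setting glue to a single strategy: they
  share the marginal \<open>\<sigma>obs e xs\<close>, which is exactly Eve's no-signalling
  condition.\<close>

lemma P_guess_ge_if_joint_decompositions:
  assumes joint: "\<And>x. x \<in> {1..m} \<Longrightarrow> joint_decomposition d (\<lambda>e. \<sigma>obs e xs) (\<lambda>a. \<sigma>obs a x) (G x)"
    and xs: "xs \<in> {1..m}"
  shows "(\<Sum>a<d. Re (trace (\<sigma>obs a xs))) \<le> P_guess d m \<sigma>obs xs"
proof -
  \<comment> \<open>At \<open>xs\<close> itself a diagonal family replaces \<open>G xs\<close>,
    which need not be diagonal, so that every guess is correct.\<close>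
  define \<sigma> where "\<sigma> e a x = (if x = xs then if a = e then \<sigma>obs e xs else 0 else G x e a)" for e a x
  have pobs: "psd (\<sigma>obs e xs)" if "e < d" for e
  proof -
    have "psd (\<Sum>a<d. G xs e a)"
      using joint[OF xs] that by (intro psd_sum) (auto simp: joint_decomposition_def)
    then show ?thesis using joint[OF xs] that by (simp add: joint_decomposition_def)
  qed
  have "psd (\<sigma> e a x)" if "e < d" "a < d" "x \<in> {1..m}" for e a x
    using joint[OF that(3)] pobs that by (auto simp: \<sigma>_def joint_decomposition_def psd_zero)
  moreover have "(\<Sum>e<d. \<sigma> e a x) = \<sigma>obs a x" if "a < d" "x \<in> {1..m}" for a x
    using joint[OF that(2)] that by (cases "x = xs") (auto simp: \<sigma>_def joint_decomposition_def)
  moreover have "(\<Sum>a<d. \<sigma> e a x) = \<sigma>obs e xs" if "e < d" "x \<in> {1..m}" for e x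
    using joint[OF that(2)] that by (cases "x = xs") (auto simp: \<sigma>_def joint_decomposition_def)
  ultimately have "guessing_feasible d m \<sigma>obs \<sigma>" by (simp add: guessing_feasible_def)
  moreover have "(\<Sum>e<d. Re (trace (\<sigma> e e xs))) = (\<Sum>a<d. Re (trace (\<sigma>obs a xs)))"
    by (simp add: \<sigma>_def)
  moreover have "bdd_above {(\<Sum>e<d. Re (trace (\<sigma> e e xs))) | \<sigma>. guessing_feasible d m \<sigma>obs \<sigma>}"
    using guessing_value_le[OF _ xs] by (auto intro!: bdd_aboveI)
  ultimately show ?thesis
    unfolding P_guess_def by (metis (mono_tags, lifting) cSup_upper mem_Collect_eq)
qed

section \<open>Assemblages of quantum states\<close>

lemma assemblage_nth:
  fixes \<rho> :: "complex ^ ('a::finite \<times> 'b::finite) ^ ('a \<times> 'b)"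
  shows "assemblage \<rho> M a x $ k $ l = (\<Sum>i\<in>UNIV. \<Sum>j\<in>UNIV. M a x $ i $ j * \<rho> $ (j, k) $ (i, l))"
proof -
  have "(\<Sum>p\<in>UNIV. M a x $ i $ fst p * mat 1 $ k $ snd p * \<rho> $ p $ (i, l)) =
     (\<Sum>j\<in>UNIV. M a x $ i $ j * \<rho> $ (j, k) $ (i, l))" for i
    unfolding UNIV_Times_UNIV[symmetric] sum.cartesian_product'
    by (simp add: mat_def if_distrib if_distribR cong: if_cong)
  then show ?thesis
    by (simp add: assemblage_def partial_trace_A_def tensor_op_def matrix_matrix_mult_def)
qed

text \<open>For fixed \<open>v\<close> the form of the assemblage element is the trace pairing of
  \<open>M a x\<close> with a positive matrix on A, obtained by compressing \<rho> with
  \<open>v\<close> on the B factor.\<close>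

lemma psd_assemblage:
  fixes \<rho> :: "complex ^ ('a::finite \<times> 'b::finite) ^ ('a \<times> 'b)"
  assumes "psd \<rho>" "psd (M a x)"
  shows "psd (assemblage \<rho> M a x)"
  unfolding psd_def
proof (intro conjI allI)
  have hr: "cnj (\<rho> $ p $ q) = \<rho> $ q $ p" for p q by (rule psd_cnj[OF assms(1)])
  have hm: "cnj (M a x $ p $ q) = M a x $ q $ p" for p q by (rule psd_cnj[OF assms(2)])
  show "hermitian (assemblage \<rho> M a x)"
    unfolding hermitian_def assemblage_nth
    by (intro allI, simp add: hr hm, rule sum.swap)
  fix v :: "complex ^ 'b"
  \<comment> \<open>\<open>R\<close> is this compression; its form at \<open>u\<close> is the form
    of \<rho> at the product vector \<open>w\<close> of \<open>u\<close> and
    \<open>v\<close>.\<close>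
  define R :: "complex ^ 'a ^ 'a" where
    "R = (\<chi> j i. \<Sum>k\<in>UNIV. \<Sum>l\<in>UNIV. cnj (v $ k) * \<rho> $ (j, k) $ (i, l) * v $ l)"
  have "psd R"
    unfolding psd_def
  proof (intro conjI allI)
    show "hermitian R"
      unfolding hermitian_def R_def
      by (intro allI, simp add: hr mult_ac, rule sum.swap)
    fix u :: "complex ^ 'a"
    define w :: "complex ^ ('a \<times> 'b)" where "w = (\<chi> p. u $ fst p * v $ snd p)"
    have "(\<Sum>p\<in>UNIV. cnj (w $ p) * (\<rho> *v w) $ p) =
       (\<Sum>j\<in>UNIV. \<Sum>k\<in>UNIV. \<Sum>i\<in>UNIV. \<Sum>l\<in>UNIV.
         cnj (u $ j) * cnj (v $ k) * \<rho> $ (j, k) $ (i, l) * u $ i * v $ l)"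
      unfolding UNIV_Times_UNIV[symmetric] sum.cartesian_product' matrix_vector_mult_def
      by (simp add: w_def sum_distrib_left mult_ac)
    also have "\<dots> = (\<Sum>j\<in>UNIV. \<Sum>i\<in>UNIV. \<Sum>k\<in>UNIV. \<Sum>l\<in>UNIV.
         cnj (u $ j) * cnj (v $ k) * \<rho> $ (j, k) $ (i, l) * u $ i * v $ l)"
      by (intro sum.cong refl sum.swap)
    also have "\<dots> = (\<Sum>j\<in>UNIV. cnj (u $ j) * (R *v u) $ j)"
      unfolding matrix_vector_mult_def
      by (simp add: R_def sum_distrib_left sum_distrib_right mult_ac)
    finally show "0 \<le> Re (\<Sum>j\<in>UNIV. cnj (u $ j) * (R *v u) $ j)"
      using psd_quadratic_form[OF assms(1), of w] by simp
  qed
  \<comment> \<open>The sums are interchanged until the A indices \<open>i\<close>, \<open>j\<close>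
    are outermost; the inner double sum is then \<open>R $ j $ i\<close>.\<close>
  have "(\<Sum>k\<in>UNIV. cnj (v $ k) * (assemblage \<rho> M a x *v v) $ k) =
     (\<Sum>k\<in>UNIV. \<Sum>l\<in>UNIV. \<Sum>i\<in>UNIV. \<Sum>j\<in>UNIV. M a x $ i $ j * (cnj (v $ k) * \<rho> $ (j, k) $ (i, l) * v $ l))"
    unfolding matrix_vector_mult_def
    by (simp add: assemblage_nth sum_distrib_left sum_distrib_right mult_ac)
  also have "\<dots> = (\<Sum>k\<in>UNIV. \<Sum>i\<in>UNIV. \<Sum>l\<in>UNIV. \<Sum>j\<in>UNIV. M a x $ i $ j * (cnj (v $ k) * \<rho> $ (j, k) $ (i, l) * v $ l))"
    by (intro sum.cong refl sum.swap)
  also have "\<dots> = (\<Sum>i\<in>UNIV. \<Sum>k\<in>UNIV. \<Sum>l\<in>UNIV. \<Sum>j\<in>UNIV. M a x $ i $ j * (cnj (v $ k) * \<rho> $ (j, k) $ (i, l) * v $ l))"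
    by (rule sum.swap)
  also have "\<dots> = (\<Sum>i\<in>UNIV. \<Sum>k\<in>UNIV. \<Sum>j\<in>UNIV. \<Sum>l\<in>UNIV. M a x $ i $ j * (cnj (v $ k) * \<rho> $ (j, k) $ (i, l) * v $ l))"
    by (intro sum.cong refl sum.swap)
  also have "\<dots> = (\<Sum>i\<in>UNIV. \<Sum>j\<in>UNIV. \<Sum>k\<in>UNIV. \<Sum>l\<in>UNIV. M a x $ i $ j * (cnj (v $ k) * \<rho> $ (j, k) $ (i, l) * v $ l))"
    by (intro sum.cong refl sum.swap)
  also have "\<dots> = (\<Sum>i\<in>UNIV. \<Sum>j\<in>UNIV. M a x $ i $ j * R $ j $ i)"
    by (simp add: R_def sum_distrib_left)
  finally show "0 \<le> Re (\<Sum>k\<in>UNIV. cnj (v $ k) * (assemblage \<rho> M a x *v v) $ k)"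
    using psd_trace_mult_nonneg[OF assms(2) \<open>psd R\<close>] by simp
qed

text \<open>Completeness of the POVM removes Alice's measurement from the sum, so the reduced state
  of B is the same for every setting.\<close>

lemma sum_assemblage:
  fixes \<rho> :: "complex ^ ('a::finite \<times> 'b::finite) ^ ('a \<times> 'b)"
  assumes "povm d (\<lambda>a. M a x)"
  shows "(\<Sum>a<d. assemblage \<rho> M a x) = partial_trace_A \<rho>"
proof -
  have s: "(\<Sum>a<d. M a x $ i $ j) = (mat 1 :: complex ^ 'a ^ 'a) $ i $ j" for i j
  proof -
    have "(\<Sum>a<d. M a x) = mat 1" using assms by (simp add: povm_def)
    then have "(\<Sum>a<d. M a x) $ i $ j = (mat 1 :: complex ^ 'a ^ 'a) $ i $ j" by simp
    then show ?thesis by simp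
  qed
  have "(\<Sum>a<d. assemblage \<rho> M a x $ k $ l) = (\<Sum>i\<in>UNIV. \<rho> $ (i, k) $ (i, l))" for k l
  proof -
    have "(\<Sum>a<d. assemblage \<rho> M a x $ k $ l) =
        (\<Sum>i\<in>UNIV. \<Sum>j\<in>UNIV. (\<Sum>a<d. M a x $ i $ j) * \<rho> $ (j, k) $ (i, l))"
      unfolding assemblage_nth sum_distrib_right
      by (subst sum.swap, intro sum.cong refl, subst sum.swap, simp)
    then show ?thesis
      unfolding s by (simp add: mat_def if_distrib if_distribR cong: if_cong)
  qed
  then show ?thesis by (simp add: vec_eq_iff partial_trace_A_def)
qed

lemma trace_partial_trace_A: "trace (partial_trace_A \<rho>) = trace \<rho>"
  unfolding trace_def partial_trace_A_def UNIV_Times_UNIV[symmetric] sum.cartesian_product'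
  by (simp, rule sum.swap)

lemma normalized_assemblage_assemblage:
  assumes "quantum_state \<rho>" "\<forall>x\<in>{1..m}. povm d (\<lambda>a. M a x)"
  shows "normalized_assemblage d m (assemblage \<rho> M)"
proof -
  have "psd (assemblage \<rho> M a x)" if "a < d" "x \<in> {1..m}" for a x
    using assms that by (intro psd_assemblage) (auto simp: quantum_state_def povm_def)
  moreover have s: "(\<Sum>a<d. assemblage \<rho> M a x) = partial_trace_A \<rho>" if "x \<in> {1..m}" for x
    using assms that by (intro sum_assemblage) auto
  moreover have "(\<Sum>a<d. Re (trace (assemblage \<rho> M a x))) = 1" if "x \<in> {1..m}" for x
    using s[OF that] assms(1)
    by (simp add: trace_partial_trace_A quantum_state_def flip: Re_trace_sum)
  ultimately show ?thesis by (simp add: normalized_assemblage_def)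
qed

section \<open>Certifiable randomness versus steerability with two settings\<close>

theorem mainTheorem4:
  fixes \<rho> :: "complex ^ ('a::finite \<times> 'b::finite) ^ ('a \<times> 'b)"
  assumes "quantum_state \<rho>"
  shows "certifies_steering_randomness \<rho> \<longleftrightarrow> steerable_with_two_settings \<rho>"
proof
  assume "certifies_steering_randomness \<rho>"
  then obtain m d M xs where M: "\<forall>x\<in>{1..m}. povm d (\<lambda>a. M a x)" and xs: "xs \<in> {1..m}"
    and P: "P_guess d m (assemblage \<rho> M) xs < 1"
    unfolding certifies_steering_randomness_def by blast
  show "steerable_with_two_settings \<rho>"
  proof (rule ccontr)
    assume "\<not> steerable_with_two_settings \<rho>"
    then have lhs: "admits_LHS d 2 (assemblage \<rho> N)" if "\<forall>x\<in>{1..2}. povm d (\<lambda>a. N a x)" for N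
      using that unfolding steerable_with_two_settings_def by blast
    have "\<exists>G. joint_decomposition d (\<lambda>e. assemblage \<rho> M e xs) (\<lambda>a. assemblage \<rho> M a x) G"
      if "x \<in> {1..m}" for x
    proof -
      \<comment> \<open>Setting 1 becomes \<open>xs\<close> and setting 2 becomes \<open>x\<close>;
        for \<open>x = xs\<close> the same POVM occurs twice, which is still an admissible
        pair.\<close>
      define N where "N a y = M a (if y = 1 then xs else x)" for a y :: nat
      have "admits_LHS d 2 (assemblage \<rho> N)"
        using M xs that by (intro lhs) (simp add: N_def)
      then obtain G where "joint_decomposition d (\<lambda>e. assemblage \<rho> N e 1) (\<lambda>a. assemblage \<rho> N a 2) G"
        by (rule joint_decomposition_if_admits_LHS_2)
      then show ?thesis by (auto simp: assemblage_def N_def)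
    qed
    then obtain G where "\<And>x. x \<in> {1..m} \<Longrightarrow>
        joint_decomposition d (\<lambda>e. assemblage \<rho> M e xs) (\<lambda>a. assemblage \<rho> M a x) (G x)"
      by metis
    from P_guess_ge_if_joint_decompositions[of m d "assemblage \<rho> M" xs G, OF this xs] P show False
      using normalized_assemblageD(3)[OF normalized_assemblage_assemblage[OF assms M] xs] by simp
  qed
next
  assume "steerable_with_two_settings \<rho>"
  then obtain d M where M: "\<forall>x\<in>{1..2}. povm d (\<lambda>a. M a x)"
    and steer: "\<not> admits_LHS d 2 (assemblage \<rho> M)"
    unfolding steerable_with_two_settings_def by blast
  note na = normalized_assemblage_assemblage[OF assms M]
  have tr: "(\<Sum>a<d. Re (trace (assemblage \<rho> M a 1))) = 1"
    using normalized_assemblageD(3)[OF na] by simp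
  \<comment> \<open>The steerable settings themselves certify randomness: a perfect guess for
    setting 1 would couple it with setting 2 and yield a local-hidden-state model.\<close>
  have "P_guess d 2 (assemblage \<rho> M) 1 < 1"
  proof (rule ccontr)
    assume "\<not> P_guess d 2 (assemblage \<rho> M) 1 < 1"
    moreover obtain \<sigma> where feas: "guessing_feasible d 2 (assemblage \<rho> M) \<sigma>"
      and "P_guess d 2 (assemblage \<rho> M) 1 \<le> (\<Sum>e<d. Re (trace (\<sigma> e e 1)))"
      using P_guess_attained[OF na, of 1] by auto
    ultimately have "joint_decomposition d (\<lambda>e. assemblage \<rho> M e 1) (\<lambda>a. assemblage \<rho> M a 2) (\<lambda>e a. \<sigma> e a 2)"
      using tr by (intro joint_decomposition_if_perfect_guess[OF feas]) auto
    then show False using admits_LHS_2_if_joint_decomposition tr steer by blast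
  qed
  \<comment> \<open>Two-setting steerability states no lower bound on \<open>d\<close>; the unit
    trace supplies it.\<close>
  moreover have "1 \<le> d" using tr by (cases d) auto
  ultimately show "certifies_steering_randomness \<rho>"
    unfolding certifies_steering_randomness_def using M
    by (intro exI[of _ 2] exI[of _ d] exI[of _ M] exI[of _ 1]) auto
qed

end
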